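(* For every real $g>0$, $$\int_0^\infty \left(\pi^5 e^{-\pi^3 x^2/g}+g^{5/2}e^{-gx^2/\pi}\right)\frac{x^2}{\cosh \pi x}\,dx=\frac{\pi g^{3/2}}{2}\int_0^\infty \frac{e^{-g x^2/\pi}}{\cosh \pi x}\,dx.$$
   Context: $\cosh$ is the hyperbolic cosine and $\cosh \pi x=\cosh(\pi x)$. *)

theory Defs
  imports "HOL-Analysis.Analysis"
begin

end

theory Submission
  imports Defs "HOL-Complex_Analysis.Complex_Analysis" "HOL-Probability.Probability" "HOL-Real_Asymp.Real_Asymp"
begin

text \<open>
  Let \<open>F a\<close> be the integral of \<open>exp (- a x\<^sup>2) / cosh (\<pi> x)\<close> over the real line. The function
  \<open>1 / cosh (\<pi> x)\<close> is its own Fourier transform, and that of a Gaussian is a Gaussian, so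
  Parseval gives \<open>F a = sqrt (\<pi> / a) F (\<pi>\<^sup>2 / a)\<close>. Differentiating this relation in \<open>a\<close> and
  setting \<open>a = g / \<pi>\<close> yields the identity.
\<close>

section \<open>Integrability of Gaussians weighted by \<open>1 / cosh (pi * x)\<close>\<close>

text \<open>The quartic growth leaves an integrable \<open>1 / (1 + x\<^sup>2)\<close> even after a
  factor \<open>1 + x\<^sup>2\<close> in the numerator. With \<open>c = cosh (pi * x / 2)\<close>,
  the double-angle formula gives \<open>2 * c\<^sup>2 - 1\<close>, which is at least
  \<open>c\<^sup>2\<close> because \<open>c\<^sup>2\<close> is at least 1.\<close>

lemma cosh_pi_ge_square: "cosh (pi * x) \<ge> (1 + x\<^sup>2)\<^sup>2" for x :: real
proof -
  \<comment> \<open>From \<open>cosh y = 1 + 2 * (sinh (y / 2))\<^sup>2\<close> and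
    \<open>sinh u \<ge> u\<close> for nonnegative \<open>u\<close>.\<close>
  have one_plus: "cosh y \<ge> 1 + y\<^sup>2 / 2" for y :: real
  proof -
    have "sinh 0 - 0 \<le> sinh (\<bar>y\<bar> / 2) - \<bar>y\<bar> / 2"
    proof (rule DERIV_nonneg_imp_nondecreasing[where f = "\<lambda>x. sinh x - x"])
      show "\<exists>d. ((\<lambda>x. sinh x - x) has_real_derivative d) (at x) \<and> d \<ge> 0" for x :: real
        by (rule exI[of _ "cosh x - 1"]) (auto intro!: derivative_eq_intros simp: cosh_real_ge_1)
    qed simp
    then have "sinh (\<bar>y\<bar> / 2) \<ge> \<bar>y\<bar> / 2" by simp
    then have "(sinh (\<bar>y\<bar> / 2))\<^sup>2 \<ge> (\<bar>y\<bar> / 2)\<^sup>2"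
      by (intro power_mono) auto
    then show ?thesis
      using cosh_double_cosh[of "\<bar>y\<bar> / 2"] cosh_square_eq[of "\<bar>y\<bar> / 2"]
      by (simp add: power_divide)
  qed
  \<comment> \<open>At \<open>y = pi * x / 2\<close> the quadratic term is
    \<open>pi\<^sup>2 * x\<^sup>2 / 8\<close>, so 8 is exactly what is required to dominate
    \<open>x\<^sup>2\<close>.\<close>
  have pi2: "pi\<^sup>2 \<ge> 8"
    using power_mono[of 3 pi 2] pi_gt3 by simp
  have "1 + x\<^sup>2 \<le> 1 + (pi * x / 2)\<^sup>2 / 2"
    using mult_right_mono[OF pi2, of "x\<^sup>2"] by (simp add: power_mult_distrib power_divide)
  also have "\<dots> \<le> cosh (pi * x / 2)"
    by (rule one_plus)
  finally have c: "1 + x\<^sup>2 \<le> cosh (pi * x / 2)" .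
  have "(1 + x\<^sup>2)\<^sup>2 \<le> (cosh (pi * x / 2))\<^sup>2"
    using c by (intro power_mono) auto
  moreover have "cosh (pi * x) = 2 * (cosh (pi * x / 2))\<^sup>2 - 1"
    using cosh_double_cosh[of "pi * x / 2"] by simp
  moreover have "(1::real) \<le> (cosh (pi * x / 2))\<^sup>2"
    using cosh_real_ge_1[of "pi * x / 2"] by simp
  ultimately show ?thesis by linarith
qed

lemma borel_measurable_cosh [measurable (raw)]:
  fixes f :: "'a \<Rightarrow> real"
  assumes "f \<in> borel_measurable M"
  shows "(\<lambda>x. cosh (f x)) \<in> borel_measurable M"
  by (rule borel_measurable_continuous_on[OF _ assms]) (intro continuous_intros)

lemma integrable_inverse_1_plus_square_lborel:
  "integrable lborel (\<lambda>x::real. inverse (1 + x\<^sup>2))"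
  using integrable_inverse_1_plus_square
  by (simp add: set_integrable_def einterval_def)

text \<open>Both integrands are nonnegative summands of
  \<open>(1 + x\<^sup>2) * exp (- (a * x\<^sup>2)) / cosh (pi * x)\<close>, so one bound by
  \<open>inverse (1 + x\<^sup>2)\<close> serves both. The case \<open>a = 0\<close> later supplies
  dominating functions.\<close>

lemma integrable_gaussian_sech:
  fixes a :: real
  assumes "a \<ge> 0"
  shows "integrable lborel (\<lambda>x. exp (- (a * x\<^sup>2)) / cosh (pi * x))"
    and "integrable lborel (\<lambda>x. x\<^sup>2 * exp (- (a * x\<^sup>2)) / cosh (pi * x))"
proof -
  have bound: "(1 + x\<^sup>2) * exp (- (a * x\<^sup>2)) / cosh (pi * x) \<le> inverse (1 + x\<^sup>2)" for x :: real
  proof -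
    have "(1 + x\<^sup>2) * exp (- (a * x\<^sup>2)) / cosh (pi * x) \<le> (1 + x\<^sup>2) * 1 / (1 + x\<^sup>2)\<^sup>2"
      using assms cosh_pi_ge_square[of x]
      by (intro frac_le mult_left_mono) (auto simp: add_pos_nonneg add_nonneg_eq_0_iff)
    also have "\<dots> = inverse (1 + x\<^sup>2)"
      using add_pos_nonneg[of 1 "x\<^sup>2"] by (simp add: power2_eq_square divide_simps)
    finally show ?thesis .
  qed
  have nn: "exp (- (a * x\<^sup>2)) / cosh (pi * x) \<ge> 0" "x\<^sup>2 * exp (- (a * x\<^sup>2)) / cosh (pi * x) \<ge> 0" for x
    by auto
  have bound': "exp (- (a * x\<^sup>2)) / cosh (pi * x) \<le> inverse (1 + x\<^sup>2)"
      "x\<^sup>2 * exp (- (a * x\<^sup>2)) / cosh (pi * x) \<le> inverse (1 + x\<^sup>2)" for x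
    using bound[of x] nn[of x] unfolding distrib_right add_divide_distrib mult_1 by linarith+
  show "integrable lborel (\<lambda>x. exp (- (a * x\<^sup>2)) / cosh (pi * x))"
  proof (rule Bochner_Integration.integrable_bound[OF integrable_inverse_1_plus_square_lborel])
    show "AE x in lborel. norm (exp (- (a * x\<^sup>2)) / cosh (pi * x)) \<le> norm (inverse (1 + x\<^sup>2))"
    proof (rule AE_I2)
      fix x :: real
      show "norm (exp (- (a * x\<^sup>2)) / cosh (pi * x)) \<le> norm (inverse (1 + x\<^sup>2))"
        using bound'[of x] nn[of x] by (simp add: abs_of_nonneg)
    qed
  qed measurable
  show "integrable lborel (\<lambda>x. x\<^sup>2 * exp (- (a * x\<^sup>2)) / cosh (pi * x))"
  proof (rule Bochner_Integration.integrable_bound[OF integrable_inverse_1_plus_square_lborel])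
    show "AE x in lborel. norm (x\<^sup>2 * exp (- (a * x\<^sup>2)) / cosh (pi * x)) \<le> norm (inverse (1 + x\<^sup>2))"
    proof (rule AE_I2)
      fix x :: real
      show "norm (x\<^sup>2 * exp (- (a * x\<^sup>2)) / cosh (pi * x)) \<le> norm (inverse (1 + x\<^sup>2))"
        using bound'[of x] nn[of x] by (simp add: abs_of_nonneg)
    qed
  qed measurable
qed

section \<open>Fourier transform of \<open>1 / cosh (pi * x)\<close> by residues\<close>

text \<open>The zeros lie on the imaginary axis at heights that are half-odd integers. The open
  strip excludes the heights -1/2 and 3/2 while containing the closed strip between heights 0 and 1,
  where the contour runs.\<close>

lemma cosh_pi_eq_0_in_strip:
  assumes "cosh (of_real pi * z) = 0" "-1/2 < Im z" "Im z < 3/2"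
  shows "z = \<i> / 2"
proof -
  from assms(1) have "cos (\<i> * (of_real pi * z)) = 0"
    by (simp add: cosh_conv_cos)
  then obtain n :: int where n: "\<i> * (of_real pi * z) = of_real (of_int n * pi) + of_real pi / 2"
    by (auto simp: cos_eq_0)
  from arg_cong[OF n, of Re] have 1: "pi * - Im z = pi * (of_int n + 1/2)"
    by (simp add: algebra_simps)
  then have im: "- Im z = of_int n + 1/2"
    by (subst (asm) mult_left_cancel) auto
  from im assms(2,3) have "n = -1" by linarith
  moreover from arg_cong[OF n, of Im] have "Re z = 0" by simp
  ultimately show ?thesis using im by (simp add: complex_eq_iff)
qed

text \<open>The reverse triangle inequality for \<open>exp z + exp (-z)\<close>, taken in both
  orders to cover both signs of \<open>Re z\<close>. It makes the vertical sides of the contour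
  negligible.\<close>

lemma norm_cosh_ge_sinh: "norm (cosh z) \<ge> sinh \<bar>Re z\<bar>" for z :: complex
proof -
  have *: "norm (exp z + exp (-z)) \<ge> exp (Re z) - exp (- Re z)"
    using norm_triangle_ineq2[of "exp z" "- exp (-z)"] by simp
  have "norm (exp z + exp (-z)) \<ge> exp (- Re z) - exp (Re z)"
    using norm_triangle_ineq2[of "exp (-z)" "- exp z"] by (simp add: add.commute)
  with * show ?thesis
    by (auto simp: cosh_field_def sinh_field_def norm_divide abs_if)
qed

lemma cosh_pi_add_ii: "cosh (of_real pi * (z + \<i>)) = - cosh (of_real pi * z)"
proof -
  have 1: "exp (of_real pi * (z + \<i>)) = - exp (of_real pi * z)"
    by (simp add: ring_distribs exp_add mult.commute[of _ "\<i>"])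
  have 2: "exp (- (of_real pi * (z + \<i>))) = - exp (- (of_real pi * z))"
    unfolding exp_minus 1 by simp
  show ?thesis unfolding cosh_field_def 1 2 by (simp add: field_simps)
qed

text \<open>The zero of the denominator is simple: its derivative at \<open>\<i> / 2\<close> is
  \<open>pi * \<i>\<close>. The residue is the value of the numerator there divided by this
  derivative.\<close>

lemma residue_exp_div_cosh_pi:
  fixes t :: real
  shows "residue (\<lambda>z. exp (\<i> * t * z) / cosh (of_real pi * z)) (\<i> / 2) = exp (- t / 2) / (pi * \<i>)"
proof (rule residue_simple')
  let ?S = "{z. -1/2 < Im z \<and> Im z < 3/2}"
  show "open ?S"
    by (auto intro!: open_Collect_conj open_Collect_less continuous_intros)
  show "\<i> / 2 \<in> ?S" by simp
  show "(\<lambda>z. exp (\<i> * t * z) / cosh (of_real pi * z)) holomorphic_on ?S - {\<i> / 2}"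
    unfolding cosh_field_def[abs_def]
    using cosh_pi_eq_0_in_strip by (intro holomorphic_intros) (auto simp: cosh_field_def)
  have d: "((\<lambda>z. cosh (of_real pi * z)) has_field_derivative (pi * \<i>)) (at (\<i> / 2))"
    by (auto intro!: derivative_eq_intros simp: sinh_conv_sin) (simp add: algebra_simps)
  have c0: "cosh (of_real pi * (\<i> / 2)) = 0"
    by (simp add: cosh_zero_iff flip: exp_of_nat_mult exp_double)
  have "((\<lambda>z. (z - \<i> / 2) / cosh (of_real pi * z)) \<longlongrightarrow> inverse (pi * \<i>)) (at (\<i> / 2))"
    using tendsto_inverse[OF d[unfolded has_field_derivative_iff c0]] by simp
  then have "((\<lambda>z. exp (\<i> * t * z) * ((z - \<i> / 2) / cosh (of_real pi * z)))
      \<longlongrightarrow> exp (\<i> * t * (\<i> / 2)) * inverse (pi * \<i>)) (at (\<i> / 2))"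
    by (intro tendsto_intros)
  then show "((\<lambda>z. exp (\<i> * t * z) / cosh (of_real pi * z) * (z - \<i> / 2)) \<longlongrightarrow>
      complex_of_real (exp (- t / 2)) / (pi * \<i>)) (at (\<i> / 2))"
    by (simp add: field_simps exp_of_real[symmetric])
qed

text \<open>
  Going from the real axis to the line \<open>Im z = 1\<close> multiplies the integrand by \<open>- exp (- t)\<close>, so the
  residue at \<open>\<i> / 2\<close> determines the integral up to the contribution of the vertical sides.
\<close>

lemma sech_rectangle_integral:
  fixes t R :: real and f :: "complex \<Rightarrow> complex"
  assumes R: "R > 0"
  defines "f \<equiv> \<lambda>z. exp (\<i> * t * z) / cosh (of_real pi * z)"
  shows "norm ((1 + exp (- t)) * integral {-R..R} (\<lambda>x. f (of_real x)) - 2 * exp (- t / 2))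
           \<le> 2 * exp \<bar>t\<bar> / sinh (pi * R)"
proof -
  \<comment> \<open>An open convex neighbourhood of the rectangle with corners \<open>a1\<close>,
    \<open>a2\<close>, \<open>a3\<close>, \<open>a4\<close>, in which \<open>\<i> / 2\<close> is the
    only singularity.\<close>
  define S where "S = {z. -1/2 < Im z \<and> Im z < 3/2}"
  define a1 a2 a3 a4 where "a1 = complex_of_real (-R)" and "a2 = complex_of_real R"
    and "a3 = Complex R 1" and "a4 = Complex (-R) 1"
  have nz: "cosh (of_real pi * z) \<noteq> 0" if "z \<in> S" "z \<noteq> \<i> / 2" for z
    using cosh_pi_eq_0_in_strip[of z] that by (auto simp: S_def)
  have "open S"
    unfolding S_def by (auto intro!: open_Collect_conj open_Collect_less continuous_intros)
  have "S = {z. -1/2 < Im z} \<inter> {z. Im z < 3/2}" by (auto simp: S_def)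
  then have "convex S" by (simp only:) (intro convex_Int convex_halfspace_Im_gt convex_halfspace_Im_lt)
  have hol: "f holomorphic_on S - {\<i> / 2}"
    using nz unfolding f_def cosh_field_def[abs_def]
    by (intro holomorphic_intros) (auto simp: cosh_field_def)
  have rect: "rectpath a1 a3 = linepath a1 a2 +++ linepath a2 a3 +++ linepath a3 a4 +++ linepath a4 a1"
    by (simp add: rectpath_def a1_def a2_def a3_def a4_def Let_def complex_of_real_def)
  have img: "path_image (rectpath a1 a3) \<subseteq> S - {\<i> / 2}"
    using R by (subst path_image_rectpath) (auto simp: a1_def a3_def S_def)
  have seg: "closed_segment a1 a2 \<subseteq> S - {\<i> / 2}" "closed_segment a2 a3 \<subseteq> S - {\<i> / 2}"
    "closed_segment a3 a4 \<subseteq> S - {\<i> / 2}" "closed_segment a4 a1 \<subseteq> S - {\<i> / 2}"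
    using img unfolding rect by (auto simp: path_image_join)
  have int: "f contour_integrable_on linepath a b" if "closed_segment a b \<subseteq> S - {\<i> / 2}" for a b
    by (rule contour_integrable_continuous_linepath)
       (rule continuous_on_subset[OF holomorphic_on_imp_continuous_on[OF hol] that])
  note ints = seg[THEN int]
  have "contour_integral (rectpath a1 a3) f =
      2 * pi * \<i> * (\<Sum>p\<in>{\<i> / 2}. winding_number (rectpath a1 a3) p * residue f p)"
  proof (rule Residue_theorem[OF \<open>open S\<close> _ _ hol])
    show "connected S" using \<open>convex S\<close> by (rule convex_connected)
    show "\<forall>z. z \<notin> S \<longrightarrow> winding_number (rectpath a1 a3) z = 0"
      using R by (auto intro!: winding_number_rectpath_outside simp: a1_def a3_def S_def in_cbox_complex_iff)
  qed (use img in auto)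
  also have "\<dots> = 2 * pi * \<i> * (winding_number (rectpath a1 a3) (\<i> / 2) * residue f (\<i> / 2))"
    by simp
  also have "\<dots> = 2 * exp (- t / 2)"
  proof -
    have "winding_number (rectpath a1 a3) (\<i> / 2) = 1"
      using R by (intro winding_number_rectpath) (simp add: a1_def a3_def in_box_complex_iff)
    moreover have "residue f (\<i> / 2) = exp (- t / 2) / (pi * \<i>)"
      unfolding f_def by (rule residue_exp_div_cosh_pi)
    moreover have "2 * p * q * (1 * (e / (p * q))) = 2 * e" if "p \<noteq> 0" "q \<noteq> 0" for p q e :: complex
      using that by (simp add: field_simps)
    ultimately show ?thesis
      using complex_i_not_zero pi_neq_zero by (simp only: of_real_mult of_real_numeral of_real_eq_0_iff not_False_eq_True)
  qed
  finally have "contour_integral (rectpath a1 a3) f = 2 * exp (- t / 2)" .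
  then have sum: "contour_integral (linepath a1 a2) f + contour_integral (linepath a2 a3) f
      + contour_integral (linepath a3 a4) f + contour_integral (linepath a4 a1) f = 2 * exp (- t / 2)"
    using ints unfolding rect by (simp add: contour_integrable_joinI add.assoc)

  have bottom: "contour_integral (linepath a1 a2) f = integral {-R..R} (\<lambda>x. f (of_real x))"
    using R by (subst contour_integral_linepath_Reals_eq) (auto simp: a1_def a2_def)
  have shift: "f (z + \<i>) = - (exp (- t) * f z)" for z
  proof -
    have "exp (\<i> * t * (z + \<i>)) = exp (- t) * exp (\<i> * t * z)"
      by (simp add: ring_distribs mult_ac exp_of_real[symmetric] flip: exp_add)
    then show ?thesis
      unfolding f_def cosh_pi_add_ii by simp
  qed
  \<comment> \<open>The top side is the bottom side translated by \<open>\<i>\<close> and traversed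
    backwards. The sign from the orientation cancels the sign in \<open>shift\<close>, so top and
    bottom add up to a factor \<open>1 + exp (- t)\<close>.\<close>
  have "contour_integral (linepath a3 a4) f = - contour_integral (linepath a4 a3) f"
    using contour_integral_reversepath[of "linepath a4 a3" f] by simp
  also have "contour_integral (linepath a4 a3) f = contour_integral (linepath a1 a2) (\<lambda>z. f (z + \<i>))"
  proof -
    have "linepath a4 a3 x = linepath a1 a2 x + \<i>" for x
      by (simp add: linepath_def a1_def a2_def a3_def a4_def complex_eq_iff)
    moreover have "a3 - a4 = a2 - a1"
      by (simp add: a1_def a2_def a3_def a4_def complex_eq_iff)
    ultimately show ?thesis
      by (simp add: contour_integral_integral)
  qed
  also have "\<dots> = - (exp (- t) * contour_integral (linepath a1 a2) f)"
    unfolding shift using ints(1)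
    by (simp add: contour_integral_neg contour_integral_lmul contour_integrable_lmul)
  finally have top: "contour_integral (linepath a3 a4) f = exp (- t) * contour_integral (linepath a1 a2) f"
    by simp

  \<comment> \<open>The numerator has modulus \<open>exp (- t * Im z)\<close>, and
    \<open>Im z\<close> stays between 0 and 1. The vertical sides have length 1, so this is also a
    bound for their integrals.\<close>
  have bound: "norm (f z) \<le> exp \<bar>t\<bar> / sinh (pi * R)" if z: "\<bar>Re z\<bar> = R" "Im z \<in> {0..1}" for z
  proof -
    have "norm (exp (\<i> * t * z)) \<le> exp \<bar>t\<bar>"
    proof -
      have "\<bar>t * Im z\<bar> \<le> \<bar>t\<bar> * 1"
        unfolding abs_mult using z by (intro mult_left_mono) auto
      then show ?thesis by simp
    qed
    moreover have "norm (cosh (of_real pi * z)) \<ge> sinh (pi * R)"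
      using norm_cosh_ge_sinh[of "of_real pi * z"] z by (simp add: abs_mult)
    ultimately show ?thesis
      using R unfolding f_def norm_divide by (intro frac_le) auto
  qed
  have B: "0 \<le> exp \<bar>t\<bar> / sinh (pi * R)" using R by simp
  have right: "norm (contour_integral (linepath a2 a3) f) \<le> exp \<bar>t\<bar> / sinh (pi * R)"
  proof -
    have "norm (contour_integral (linepath a2 a3) f) \<le> exp \<bar>t\<bar> / sinh (pi * R) * norm (a3 - a2)"
      using R by (intro contour_integral_bound_linepath ints B bound)
         (auto simp: a2_def a3_def closed_segment_same_Re closed_segment_eq_real_ivl)
    then show ?thesis by (simp add: a2_def a3_def norm_complex_def)
  qed
  have left: "norm (contour_integral (linepath a4 a1) f) \<le> exp \<bar>t\<bar> / sinh (pi * R)"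
  proof -
    have "norm (contour_integral (linepath a4 a1) f) \<le> exp \<bar>t\<bar> / sinh (pi * R) * norm (a1 - a4)"
      using R by (intro contour_integral_bound_linepath ints B bound)
         (auto simp: a1_def a4_def closed_segment_same_Re closed_segment_eq_real_ivl)
    then show ?thesis by (simp add: a1_def a4_def norm_complex_def)
  qed
  have "(1 + exp (- t)) * integral {-R..R} (\<lambda>x. f (of_real x)) - 2 * exp (- t / 2) =
      - (contour_integral (linepath a2 a3) f + contour_integral (linepath a4 a1) f)"
    unfolding sum[symmetric] top bottom by (simp add: ring_distribs)
  also have "norm \<dots> \<le> exp \<bar>t\<bar> / sinh (pi * R) + exp \<bar>t\<bar> / sinh (pi * R)"
    unfolding norm_minus_cancel by (rule norm_triangle_mono[OF right left])
  finally show ?thesis by simp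
qed

lemma cosh_complex_of_real: "cosh (complex_of_real x) = of_real (cosh x)"
  by (simp add: cosh_field_def exp_of_real[symmetric])

lemma integrable_iexp_sech:
  fixes t :: real
  shows "integrable lborel (\<lambda>x. iexp (t * x) / cosh (pi * x))"
proof (rule Bochner_Integration.integrable_bound[OF integrable_gaussian_sech(1)[of 0]])
  show "AE x in lborel. norm (iexp (t * x) / cosh (pi * x)) \<le> norm (exp (- (0 * x\<^sup>2)) / cosh (pi * x))"
    by (rule AE_I2) (simp add: norm_divide)
qed (simp, measurable)

text \<open>As the rectangle widens, the error term tends to 0, which leaves
  \<open>(1 + exp (- t)) * I = 2 * exp (- t / 2)\<close> for the integral \<open>I\<close>. At
  \<open>t = 2 * pi * x\<close> the value is \<open>1 / cosh (pi * x)\<close>, the self-duality used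
  below.\<close>

lemma fourier_sech:
  fixes t :: real
  shows "(CLBINT x. iexp (t * x) / cosh (pi * x)) = 1 / cosh (t / 2)"
proof -
  define h where "h = (\<lambda>x. iexp (t * x) / cosh (pi * x))"
  have int: "integrable lborel h" unfolding h_def by (rule integrable_iexp_sech)
  have hf: "h x = exp (\<i> * t * of_real x) / cosh (of_real pi * of_real x)" for x
    by (simp add: h_def cosh_complex_of_real[symmetric] mult.assoc)
  \<comment> \<open>Dominated convergence passes from the gauge integrals over finite intervals to
    the Lebesgue integral. Taking \<open>Suc n\<close> keeps the half-width positive, as the
    rectangle estimate demands.\<close>
  have lim: "(\<lambda>n. integral {- real (Suc n)..real (Suc n)} h) \<longlonglongrightarrow> integral\<^sup>L lborel h"
  proof -
    have "integral {- real (Suc n)..real (Suc n)} h = (CLBINT x. indicator {- real (Suc n)..real (Suc n)} x *\<^sub>R h x)" for n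
    proof -
      have "set_integrable lborel {- real (Suc n)..real (Suc n)} h"
        unfolding set_integrable_def using int by (intro integrable_mult_indicator) auto
      from set_borel_integral_eq_integral(2)[OF this] show ?thesis
        by (simp add: set_lebesgue_integral_def)
    qed
    moreover have "(\<lambda>n. CLBINT x. indicator {- real (Suc n)..real (Suc n)} x *\<^sub>R h x) \<longlonglongrightarrow> integral\<^sup>L lborel h"
    proof (rule integral_dominated_convergence[where w = "\<lambda>x. norm (h x)"])
      show "AE x in lborel. (\<lambda>n. indicator {- real (Suc n)..real (Suc n)} x *\<^sub>R h x) \<longlonglongrightarrow> h x"
      proof (rule AE_I2, rule tendsto_eventually)
        fix x :: real
        obtain N :: nat where N: "\<bar>x\<bar> \<le> real N" using real_arch_simple by blast
        show "\<forall>\<^sub>F n in sequentially. indicator {- real (Suc n)..real (Suc n)} x *\<^sub>R h x = h x"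
          using eventually_ge_at_top[of N]
        proof eventually_elim
          case (elim n)
          with N have "x \<in> {- real (Suc n)..real (Suc n)}" by auto
          then show ?case by simp
        qed
      qed
      show "AE x in lborel. norm (indicator {- real (Suc n)..real (Suc n)} x *\<^sub>R h x) \<le> norm (h x)" for n
        by (rule AE_I2) (simp split: split_indicator)
    qed (use int in \<open>auto intro: borel_measurable_integrable borel_measurable_scaleR\<close>)
    ultimately show ?thesis by simp
  qed
  define I where "I = integral\<^sup>L lborel h"
  have "(\<lambda>n. (1 + exp (- t)) * integral {- real (Suc n)..real (Suc n)} h - 2 * exp (- t / 2))
      \<longlonglongrightarrow> (1 + exp (- t)) * I - 2 * exp (- t / 2)"
    unfolding I_def by (intro tendsto_intros lim)
  moreover have "(\<lambda>n. (1 + exp (- t)) * integral {- real (Suc n)..real (Suc n)} h - 2 * exp (- t / 2)) \<longlonglongrightarrow> 0"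
  proof (rule Lim_null_comparison)
    show "\<forall>\<^sub>F n in sequentially. norm ((1 + exp (- t)) * integral {- real (Suc n)..real (Suc n)} h - 2 * exp (- t / 2))
        \<le> 2 * exp \<bar>t\<bar> / sinh (pi * real (Suc n))"
      using sech_rectangle_integral[of "real (Suc _)" t] unfolding hf[abs_def]
      by (intro always_eventually allI) simp
    show "(\<lambda>n. 2 * exp \<bar>t\<bar> / sinh (pi * real (Suc n))) \<longlonglongrightarrow> 0"
      by real_asymp
  qed
  ultimately have "(1 + exp (- t)) * I - 2 * exp (- t / 2) = 0"
    by (rule LIMSEQ_unique)
  then have "complex_of_real (1 + exp (- t)) * I = of_real (2 * exp (- t / 2))" by simp
  moreover have "1 + exp (- t) \<noteq> 0" using exp_gt_zero[of "- t"] by linarith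
  ultimately have "I = of_real (2 * exp (- t / 2) / (1 + exp (- t)))"
    by (simp add: field_simps del: of_real_add of_real_mult)
  also have "2 * exp (- t / 2) / (1 + exp (- t)) = 1 / cosh (t / 2)"
  proof -
    have e: "exp (- t) = exp (- t / 2) * exp (- t / 2)" by (simp flip: exp_add)
    have "exp (t / 2) * exp (- t / 2) = 1" by (simp flip: exp_add)
    then have "exp (- t / 2) * (2 * cosh (t / 2)) = 1 + exp (- t)"
      by (simp add: e cosh_field_def algebra_simps)
    then show ?thesis
      using \<open>1 + exp (- t) \<noteq> 0\<close> cosh_real_nonzero[of "t / 2"]
      by (simp add: divide_simps mult.commute mult.left_commute)
  qed
  finally show ?thesis by (simp add: I_def h_def)
qed

section \<open>Fourier transform of a Gaussian\<close>

lemma integrable_gaussian: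
  fixes a :: real
  assumes "a > 0"
  shows "integrable lborel (\<lambda>x. exp (- (a * x\<^sup>2)))"
proof -
  have "integrable lborel (\<lambda>x::real. exp (- x\<^sup>2))"
    using has_bochner_integral_even_function[OF gaussian_moment_0]
    by (auto simp: has_bochner_integral_iff)
  then have "integrable lborel (\<lambda>x. exp (- (0 + sqrt a * x)\<^sup>2))"
    using assms by (intro lborel_integrable_real_affine) auto
  then show ?thesis
    using assms by (simp add: power_mult_distrib)
qed

text \<open>A rescaling of the characteristic function \<open>exp (- t\<^sup>2 / 2)\<close> of the
  standard normal distribution: substituting \<open>sqrt (2 * a) * x\<close> turns its density into
  a multiple of \<open>exp (- (a * x\<^sup>2))\<close>.\<close>

lemma fourier_gaussian:
  fixes a s :: real
  assumes "a > 0"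
  shows "(CLBINT x. exp (- (a * x\<^sup>2)) * iexp (s * x)) = sqrt (pi / a) * exp (- (s\<^sup>2 / (4 * a)))"
proof -
  \<comment> \<open>Chosen so that \<open>t * sqrt (2 * a) = s\<close> after the
    substitution.\<close>
  define t where "t = s / sqrt (2 * a)"
  have "exp (- t\<^sup>2 / 2) = char std_normal_distribution t"
    by (simp add: char_std_normal_distribution)
  also have "\<dots> = (CLBINT x. std_normal_density x *\<^sub>R iexp (t * x))"
    unfolding char_def by (subst integral_density) auto
  also have "\<dots> = sqrt (2 * a) *\<^sub>R (CLBINT x. std_normal_density (0 + sqrt (2 * a) * x) *\<^sub>R iexp (t * (0 + sqrt (2 * a) * x)))"
    using assms by (subst lborel_integral_real_affine[where c = "sqrt (2 * a)" and t = 0]) auto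
  also have "(\<lambda>x. std_normal_density (0 + sqrt (2 * a) * x) *\<^sub>R iexp (t * (0 + sqrt (2 * a) * x)))
      = (\<lambda>x. (1 / sqrt (2 * pi)) *\<^sub>R (exp (- (a * x\<^sup>2)) * iexp (s * x)))"
    using assms
    by (simp add: fun_eq_iff std_normal_density_def power_mult_distrib t_def scaleR_conv_of_real)
  also have "sqrt (2 * a) *\<^sub>R (CLBINT x. (1 / sqrt (2 * pi)) *\<^sub>R (exp (- (a * x\<^sup>2)) * iexp (s * x)))
      = sqrt (a / pi) * (CLBINT x. exp (- (a * x\<^sup>2)) * iexp (s * x))"
    by (simp add: scaleR_conv_of_real real_sqrt_mult real_sqrt_divide)
  finally have "sqrt (pi / a) * exp (- t\<^sup>2 / 2)
      = complex_of_real (sqrt (pi / a) * sqrt (a / pi)) * (CLBINT x. exp (- (a * x\<^sup>2)) * iexp (s * x))"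
    by simp
  also have "sqrt (pi / a) * sqrt (a / pi) = 1"
    using assms by (simp flip: real_sqrt_mult)
  also have "- t\<^sup>2 / 2 = - (s\<^sup>2 / (4 * a))"
    using assms by (simp add: t_def power_divide)
  finally show ?thesis by simp
qed

section \<open>Reciprocity under \<open>a\<close> to \<open>pi\<^sup>2 / a\<close>\<close>

definition gauss_sech :: "real \<Rightarrow> real" where
  "gauss_sech a = (LBINT x. exp (- (a * x\<^sup>2)) / cosh (pi * x))"

text \<open>Parseval takes the form of Fubini for the kernel \<open>f\<close> below. Integrating
  over \<open>y\<close> first gives the left-hand integrand by \<open>fourier_sech\<close> at
  \<open>2 * pi * x\<close>; integrating over \<open>x\<close> first gives the right-hand one by
  \<open>fourier_gaussian\<close> at \<open>2 * pi * y\<close>.\<close>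

lemma gauss_sech_reciprocity:
  assumes "a > 0"
  shows "gauss_sech a = sqrt (pi / a) * gauss_sech (pi\<^sup>2 / a)"
proof -
  define f where "f = (\<lambda>(x, y). complex_of_real (exp (- (a * x\<^sup>2))) * (iexp (2 * pi * x * y) / cosh (pi * y)))"
  have f: "f (x, y) = complex_of_real (exp (- (a * x\<^sup>2))) * (iexp (2 * pi * x * y) / cosh (pi * y))" for x y
    by (simp add: f_def)
  have norm_f: "norm (f (x, y)) = exp (- (a * x\<^sup>2)) * (1 / cosh (pi * y))" for x y
    by (simp add: f norm_mult norm_divide)
  \<comment> \<open>The oscillating factor has modulus 1, so the norm of \<open>f\<close> splits
    into a product of two integrable functions of one variable.\<close>
  have "integrable (lborel \<Otimes>\<^sub>M lborel) f"
  proof (rule lborel_pair.Fubini_integrable)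
    show "f \<in> borel_measurable (lborel \<Otimes>\<^sub>M lborel)"
      unfolding f_def by measurable
    show "integrable lborel (\<lambda>x. LBINT y. norm (f (x, y)))"
      unfolding norm_f integral_mult_right_zero
      by (intro integrable_mult_left integrable_gaussian assms)
    show "AE x in lborel. integrable lborel (\<lambda>y. f (x, y))"
      unfolding f by (intro AE_I2 integrable_mult_right integrable_iexp_sech)
  qed
  then have "(CLBINT y. CLBINT x. f (x, y)) = (CLBINT x. CLBINT y. f (x, y))"
    by (intro lborel_pair.Fubini_integral) (simp add: case_prod_beta')
  moreover have "(CLBINT y. f (x, y)) = complex_of_real (exp (- (a * x\<^sup>2)) / cosh (pi * x))" for x
    unfolding f integral_mult_right_zero using fourier_sech[of "2 * pi * x"] by simp
  moreover have "(CLBINT x. f (x, y)) = complex_of_real (sqrt (pi / a) * (exp (- (pi\<^sup>2 / a * y\<^sup>2)) / cosh (pi * y)))" for y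
  proof -
    have "(CLBINT x. f (x, y)) = (CLBINT x. exp (- (a * x\<^sup>2)) * iexp ((2 * pi * y) * x)) / cosh (pi * y)"
      unfolding f by (simp add: mult_ac)
    also have "\<dots> = complex_of_real (sqrt (pi / a) * exp (- ((2 * pi * y)\<^sup>2 / (4 * a))) / cosh (pi * y))"
      unfolding fourier_gaussian[OF assms] by simp
    also have "(2 * pi * y)\<^sup>2 / (4 * a) = pi\<^sup>2 / a * y\<^sup>2"
      by (simp add: power_mult_distrib)
    finally show ?thesis by simp
  qed
  ultimately have "(CLBINT y. complex_of_real (sqrt (pi / a) * (exp (- (pi\<^sup>2 / a * y\<^sup>2)) / cosh (pi * y))))
      = (CLBINT x. complex_of_real (exp (- (a * x\<^sup>2)) / cosh (pi * x)))"
    by simp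
  then have "(LBINT y. sqrt (pi / a) * (exp (- (pi\<^sup>2 / a * y\<^sup>2)) / cosh (pi * y)))
      = (LBINT x. exp (- (a * x\<^sup>2)) / cosh (pi * x))"
    unfolding integral_complex_of_real of_real_eq_iff .
  then show ?thesis unfolding gauss_sech_def integral_mult_right_zero by (rule sym)
qed

section \<open>Differentiating the reciprocity\<close>

text \<open>Minus the derivative of \<open>gauss_sech\<close> at positive arguments.\<close>

definition gauss_sech2 :: "real \<Rightarrow> real" where
  "gauss_sech2 a = (LBINT x. x\<^sup>2 * exp (- (a * x\<^sup>2)) / cosh (pi * x))"

text \<open>For \<open>u \<le> v\<close>, factor out \<open>exp (- u) \<le> 1\<close> and use
  \<open>1 - exp (- d) \<le> d\<close>. This Lipschitz bound controls the difference quotients in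
  the next lemma uniformly.\<close>

lemma abs_exp_minus_diff_le:
  fixes u v :: real
  assumes "u \<ge> 0" "v \<ge> 0"
  shows "\<bar>exp (- u) - exp (- v)\<bar> \<le> \<bar>u - v\<bar>"
  using assms
proof (induction u v rule: linorder_wlog)
  case (le u v)
  have "exp (- u) - exp (- v) = exp (- u) * (1 - exp (- (v - u)))"
    by (simp add: algebra_simps flip: exp_add)
  also have "\<dots> \<le> 1 * (v - u)"
  proof (rule mult_mono)
    show "1 - exp (- (v - u)) \<le> v - u"
      using exp_ge_add_one_self[of "- (v - u)"] by linarith
  qed (use le in auto)
  finally show ?case using le by simp
next
  case (sym u v)
  then show ?case by (simp add: abs_minus_commute)
qed

text \<open>Differentiation under the integral sign: along any sequence of positive parameters
  tending to \<open>a\<close>, the difference quotients of the integrand are dominated by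
  \<open>x\<^sup>2 / cosh (pi * x)\<close>. As \<open>{0<..}\<close> is open, the derivative within
  it is the full derivative.\<close>

lemma gauss_sech_has_derivative:
  assumes "a > 0"
  shows "(gauss_sech has_real_derivative - gauss_sech2 a) (at a)"
proof -
  have "((\<lambda>b. (gauss_sech b - gauss_sech a) / (b - a)) \<longlongrightarrow> - gauss_sech2 a) (at a within {0<..})"
    unfolding tendsto_at_iff_sequentially comp_def
  proof (intro allI impI)
    fix b :: "nat \<Rightarrow> real"
    assume "\<forall>i. b i \<in> {0<..} - {a}" and lim: "b \<longlonglongrightarrow> a"
    then have b: "b n > 0" "b n \<noteq> a" for n by auto
    define q where "q = (\<lambda>n x. (exp (- (b n * x\<^sup>2)) - exp (- (a * x\<^sup>2))) / (b n - a) / cosh (pi * x))"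
    have q_eq: "q n x = (exp (- (b n * x\<^sup>2)) / cosh (pi * x) - exp (- (a * x\<^sup>2)) / cosh (pi * x)) / (b n - a)" for n x
      by (simp add: q_def diff_divide_distrib mult.commute)
    have "(gauss_sech (b n) - gauss_sech a) / (b n - a) = (LBINT x. q n x)" for n
      unfolding q_eq gauss_sech_def using integrable_gaussian_sech(1) b[of n] assms by simp
    moreover have "(\<lambda>n. LBINT x. q n x) \<longlonglongrightarrow> (LBINT x. - (x\<^sup>2 * exp (- (a * x\<^sup>2)) / cosh (pi * x)))"
    \<comment> \<open>The trivial factor \<open>exp (- (0 * x\<^sup>2))\<close> puts the dominating
      function in the form of \<open>integrable_gaussian_sech\<close> with
      \<open>a = 0\<close>.\<close>
    proof (rule integral_dominated_convergence[where w = "\<lambda>x. x\<^sup>2 * exp (- (0 * x\<^sup>2)) / cosh (pi * x)"])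
      show "integrable lborel (\<lambda>x. x\<^sup>2 * exp (- (0 * x\<^sup>2)) / cosh (pi * x))"
        by (rule integrable_gaussian_sech) simp
      show "AE x in lborel. (\<lambda>n. q n x) \<longlonglongrightarrow> - (x\<^sup>2 * exp (- (a * x\<^sup>2)) / cosh (pi * x))"
      proof (rule AE_I2)
        fix x :: real
        have "((\<lambda>b. exp (- (b * x\<^sup>2))) has_real_derivative - (x\<^sup>2 * exp (- (a * x\<^sup>2)))) (at a)"
          by (auto intro!: derivative_eq_intros)
        then have "((\<lambda>b. (exp (- (b * x\<^sup>2)) - exp (- (a * x\<^sup>2))) / (b - a)) \<longlongrightarrow> - (x\<^sup>2 * exp (- (a * x\<^sup>2)))) (at a)"
          by (simp add: has_field_derivative_iff)
        then have "(\<lambda>n. (exp (- (b n * x\<^sup>2)) - exp (- (a * x\<^sup>2))) / (b n - a)) \<longlonglongrightarrow> - (x\<^sup>2 * exp (- (a * x\<^sup>2)))"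
          using lim b by (auto simp: tendsto_at_iff_sequentially comp_def)
        from tendsto_divide[OF this tendsto_const[of "cosh (pi * x)"]]
        show "(\<lambda>n. q n x) \<longlonglongrightarrow> - (x\<^sup>2 * exp (- (a * x\<^sup>2)) / cosh (pi * x))"
          by (simp add: q_def)
      qed
      show "AE x in lborel. norm (q n x) \<le> x\<^sup>2 * exp (- (0 * x\<^sup>2)) / cosh (pi * x)" for n
      proof (rule AE_I2)
        fix x :: real
        have "\<bar>exp (- (b n * x\<^sup>2)) - exp (- (a * x\<^sup>2))\<bar> \<le> \<bar>b n * x\<^sup>2 - a * x\<^sup>2\<bar>"
          using b[of n] assms by (intro abs_exp_minus_diff_le) auto
        also have "\<dots> = \<bar>b n - a\<bar> * x\<^sup>2"
          by (simp add: abs_mult flip: left_diff_distrib)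
        finally have "\<bar>(exp (- (b n * x\<^sup>2)) - exp (- (a * x\<^sup>2))) / (b n - a)\<bar> \<le> x\<^sup>2"
          using b[of n] by (simp add: abs_divide divide_le_eq mult.commute)
        from divide_right_mono[OF this, of "cosh (pi * x)"]
        show "norm (q n x) \<le> x\<^sup>2 * exp (- (0 * x\<^sup>2)) / cosh (pi * x)"
          by (simp add: q_def abs_mult)
      qed
    qed (unfold q_def, measurable)
    ultimately show "(\<lambda>n. (gauss_sech (b n) - gauss_sech a) / (b n - a)) \<longlonglongrightarrow> - gauss_sech2 a"
      by (simp add: gauss_sech2_def)
  qed
  then have "(gauss_sech has_real_derivative - gauss_sech2 a) (at a within {0<..})"
    by (simp add: has_field_derivative_iff)
  then show ?thesis
    using assms by (simp add: at_within_open[of a "{0<..}"])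
qed

text \<open>Both sides of \<open>gauss_sech_reciprocity\<close> are differentiated and compared by
  uniqueness of derivatives. The term from \<open>sqrt (pi / b)\<close> contains
  \<open>sqrt (pi / a) * gauss_sech (pi\<^sup>2 / a)\<close>, which the reciprocity turns back into
  \<open>gauss_sech a\<close>.\<close>

lemma gauss_sech2_reciprocity:
  assumes "a > 0"
  shows "gauss_sech2 a + sqrt (pi / a) * (pi\<^sup>2 / a\<^sup>2) * gauss_sech2 (pi\<^sup>2 / a) = gauss_sech a / (2 * a)"
proof -
  have d_sqrt: "((\<lambda>b. sqrt (pi / b)) has_real_derivative - (sqrt (pi / a) / (2 * a))) (at a)"
  proof -
    have "((\<lambda>b. sqrt (pi / b)) has_real_derivative inverse (sqrt (pi / a)) / 2 * (- pi / a\<^sup>2)) (at a)"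
    proof (rule DERIV_chain2[OF DERIV_real_sqrt])
      show "((\<lambda>b. pi / b) has_real_derivative - pi / a\<^sup>2) (at a)"
        using assms by (auto intro!: derivative_eq_intros simp: power2_eq_square)
    qed (use assms in simp)
    also have "inverse (sqrt (pi / a)) / 2 * (- pi / a\<^sup>2) = - (sqrt (pi / a) / (2 * a))"
    proof -
      have "- pi / a\<^sup>2 = - (sqrt (pi / a) * sqrt (pi / a) / a)"
        using assms by (simp add: power2_eq_square)
      moreover have "inverse r / 2 * - (r * r / a) = - (r / (2 * a))" if "r \<noteq> 0" for r :: real
        using that by simp
      moreover have "sqrt (pi / a) \<noteq> 0" using assms by simp
      ultimately show ?thesis by metis
    qed
    finally show ?thesis .
  qed
  have d_inv: "((\<lambda>b. pi\<^sup>2 / b) has_real_derivative - (pi\<^sup>2 / a\<^sup>2)) (at a)"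
    using assms by (auto intro!: derivative_eq_intros simp: power2_eq_square)
  have "((\<lambda>b. gauss_sech (pi\<^sup>2 / b)) has_real_derivative - gauss_sech2 (pi\<^sup>2 / a) * - (pi\<^sup>2 / a\<^sup>2)) (at a)"
    using assms by (intro DERIV_chain2[OF gauss_sech_has_derivative d_inv]) simp
  from DERIV_mult[OF d_sqrt this]
  have "((\<lambda>b. sqrt (pi / b) * gauss_sech (pi\<^sup>2 / b)) has_real_derivative
      - (sqrt (pi / a) / (2 * a)) * gauss_sech (pi\<^sup>2 / a)
      + - gauss_sech2 (pi\<^sup>2 / a) * - (pi\<^sup>2 / a\<^sup>2) * sqrt (pi / a)) (at a)" (is "(_ has_real_derivative ?D) _") .
  \<comment> \<open>Equal derivatives require the reciprocity on a neighbourhood of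
    \<open>a\<close>, and it holds at every positive \<open>b\<close>.\<close>
  moreover have "\<forall>\<^sub>F b in nhds a. sqrt (pi / b) * gauss_sech (pi\<^sup>2 / b) = gauss_sech b"
    using eventually_nhds_in_open[of "{0<..}" a] assms
    by (auto elim!: eventually_mono simp flip: gauss_sech_reciprocity)
  ultimately have "(gauss_sech has_real_derivative ?D) (at a)"
    by (subst (asm) DERIV_cong_ev[OF refl _ refl]) 
  then have "?D = - gauss_sech2 a"
    using gauss_sech_has_derivative[OF assms] by (rule DERIV_unique)
  then show ?thesis
    by (subst gauss_sech_reciprocity[OF assms]) (simp add: mult_ac)
qed

section \<open>From the real line to the half-line, and the identity\<close>

lemma LBINT_even_half_line:
  fixes f :: "real \<Rightarrow> real"
  assumes "integrable lborel f" "\<And>x. f (- x) = f x"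
  shows "set_integrable lborel {0..} f" "(LBINT x:{0..}. f x) = integral\<^sup>L lborel f / 2"
proof -
  show s: "set_integrable lborel {0..} f"
    unfolding set_integrable_def using assms(1) by (intro integrable_mult_indicator) auto
  have "has_bochner_integral lborel f (2 *\<^sub>R (LBINT x:{0..}. f x))"
    using s assms(2) unfolding set_integrable_def set_lebesgue_integral_def
    by (intro has_bochner_integral_even_function has_bochner_integral_integrable)
  then show "(LBINT x:{0..}. f x) = integral\<^sup>L lborel f / 2"
    by (simp add: has_bochner_integral_integral_eq)
qed

theorem mainTheorem12:
  fixes g :: real
  assumes "g > 0"
  shows "set_integrable lborel {0..} (\<lambda>x. (pi ^ 5 * exp (- (pi ^ 3 * x\<^sup>2 / g)) +
             g powr (5 / 2) * exp (- (g * x\<^sup>2 / pi))) * (x\<^sup>2 / cosh (pi * x)))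
       \<and> set_integrable lborel {0..} (\<lambda>x. exp (- (g * x\<^sup>2 / pi)) / cosh (pi * x))
       \<and> (LBINT x:{0..}. (pi ^ 5 * exp (- (pi ^ 3 * x\<^sup>2 / g)) +
             g powr (5 / 2) * exp (- (g * x\<^sup>2 / pi))) * (x\<^sup>2 / cosh (pi * x)))
         = pi * g powr (3 / 2) / 2 * (LBINT x:{0..}. exp (- (g * x\<^sup>2 / pi)) / cosh (pi * x))"
proof -
  \<comment> \<open>With this choice \<open>pi\<^sup>2 / a = pi ^ 3 / g\<close>, so the two
    Gaussians on the left are the ones that the reciprocity pairs.\<close>
  define a where "a = g / pi"
  have a: "a > 0" using assms by (simp add: a_def)
  let ?l = "\<lambda>x. (pi ^ 5 * exp (- (pi ^ 3 * x\<^sup>2 / g)) +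
             g powr (5 / 2) * exp (- (g * x\<^sup>2 / pi))) * (x\<^sup>2 / cosh (pi * x))"
  let ?r = "\<lambda>x. exp (- (g * x\<^sup>2 / pi)) / cosh (pi * x)"
  have l: "?l = (\<lambda>x. pi ^ 5 * (x\<^sup>2 * exp (- (pi\<^sup>2 / a * x\<^sup>2)) / cosh (pi * x))
      + g powr (5 / 2) * (x\<^sup>2 * exp (- (a * x\<^sup>2)) / cosh (pi * x)))"
    using assms by (simp add: fun_eq_iff a_def field_simps power2_eq_square power3_eq_cube)
  have r: "?r = (\<lambda>x. exp (- (a * x\<^sup>2)) / cosh (pi * x))"
    by (simp add: a_def)
  have int: "integrable lborel (\<lambda>x. x\<^sup>2 * exp (- (pi\<^sup>2 / a * x\<^sup>2)) / cosh (pi * x))"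
    "integrable lborel (\<lambda>x. x\<^sup>2 * exp (- (a * x\<^sup>2)) / cosh (pi * x))"
    "integrable lborel (\<lambda>x. exp (- (a * x\<^sup>2)) / cosh (pi * x))"
    using a by (intro integrable_gaussian_sech; simp)+
  have int_l: "integrable lborel ?l" unfolding l by (intro Bochner_Integration.integrable_add integrable_mult_right int)
  have int_r: "integrable lborel ?r" unfolding r by (rule int)
  \<comment> \<open>Here \<open>sqrt (pi / a) = pi / sqrt g\<close> and
    \<open>pi\<^sup>2 / a\<^sup>2 = pi ^ 4 / g\<^sup>2\<close>. The left-hand integral thus becomes
    \<open>g powr (5 / 2)\<close> times the left side of
    \<open>gauss_sech2_reciprocity\<close>.\<close>
  have pi5: "pi ^ 5 = g powr (5 / 2) * (sqrt (pi / a) * (pi\<^sup>2 / a\<^sup>2))"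
  proof -
    have "g powr (5 / 2) = g powr (2 + 1 / 2)" by simp
    also have "\<dots> = g\<^sup>2 * sqrt g"
      using assms unfolding powr_add by (simp add: powr_half_sqrt)
    finally have "g powr (5 / 2) = g\<^sup>2 * sqrt g" .
    moreover have "sqrt (pi / a) = pi / sqrt g"
      by (simp add: a_def real_sqrt_divide)
    moreover have "pi\<^sup>2 / a\<^sup>2 = pi ^ 4 / g\<^sup>2"
      by (simp add: a_def power_divide flip: power_add)
    moreover have "pi ^ 5 = pi * pi ^ 4"
      by (simp add: eval_nat_numeral)
    ultimately show ?thesis using assms by simp
  qed
  have g52: "g powr (5 / 2) = g powr (3 / 2) * g"
    using assms powr_add[of g "3 / 2" 1] by simp
  have "integral\<^sup>L lborel ?l = pi ^ 5 * gauss_sech2 (pi\<^sup>2 / a) + g powr (5 / 2) * gauss_sech2 a"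
    unfolding l gauss_sech2_def
    by (subst Bochner_Integration.integral_add)
       (intro integrable_mult_right int integral_mult_right_zero arg_cong2[of _ _ _ _ "(+)"])+
  also have "\<dots> = g powr (5 / 2) * (gauss_sech2 a + sqrt (pi / a) * (pi\<^sup>2 / a\<^sup>2) * gauss_sech2 (pi\<^sup>2 / a))"
    unfolding pi5 by (simp only: distrib_left mult.assoc add.commute)
  also have "\<dots> = g powr (3 / 2) * g * (gauss_sech a / (2 * a))"
    unfolding gauss_sech2_reciprocity[OF a] g52 ..
  \<comment> \<open>The constant comes from \<open>g / (2 * a) = pi / 2\<close>.\<close>
  also have "\<dots> = pi * g powr (3 / 2) / 2 * integral\<^sup>L lborel ?r"
    unfolding r gauss_sech_def[symmetric] using assms by (simp add: a_def)
  finally have eq: "integral\<^sup>L lborel ?l = pi * g powr (3 / 2) / 2 * integral\<^sup>L lborel ?r" .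
  \<comment> \<open>All integrands are even, so passing to the half-line halves both sides of
    \<open>eq\<close>.\<close>
  have half: "set_integrable lborel {0..} ?l" "(LBINT x:{0..}. ?l x) = integral\<^sup>L lborel ?l / 2"
    "set_integrable lborel {0..} ?r" "(LBINT x:{0..}. ?r x) = integral\<^sup>L lborel ?r / 2"
    by (rule LBINT_even_half_line[OF int_l] LBINT_even_half_line[OF int_r]; simp)+
  show ?thesis
    unfolding half(2,4) eq using half(1,3) by simp
qed

end
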